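(* Let $k\ge 3$ be an integer and let $E(2.O_k)$ be the extended graph of the bipartite double of the Odd graph $O_k$. Then the automorphism group of $E(2.O_k)$ is isomorphic to $\mathbb{Z}_2\times\mathrm{Sym}(2k-1)$.
   Context: For $k\ge 3$, let $\Omega=\{1,\dots,2k-1\}$. The extended graph $E(2.O_k)$ is the simple graph with vertex set $\{(v,i) : v\subset\Omega,\ |v|=k-1,\ i\in\{0,1\}\}$ in which $(v,i)$ and $(w,j)$ are adjacent if and only if $i\ne j$ and either $v\cap w=\emptyset$ or $v=w$. $\mathrm{Sym}(n)$ denotes the symmetric group on $n$ points. *)

theory Defs
  imports
    "Graph_Theory.Pair_Digraph"
    "HOL-Algebra.Bij"
    "HOL-Algebra.Elementary_Groups"
    "HOL-Algebra.Sym_Groups"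
begin

text \<open>
  The extended graph \<open>E(2.O\<^sub>k)\<close>. As usual in the graph library, a simple graph is a finite
  symmetric loop-free digraph (locale \<^locale>\<open>pair_graph\<close>): each edge is represented by its
  two opposite arcs.
\<close>

definition extended_2_odd_graph :: "nat \<Rightarrow> (nat set \<times> nat) pair_pre_digraph" where
  "extended_2_odd_graph k =
     (let V = {v. v \<subseteq> {1..2 * k - 1} \<and> card v = k - 1} \<times> {0, 1}
      in \<lparr>pverts = V,
          parcs = {((v, i), (w, j)) | v i w j.
                     (v, i) \<in> V \<and> (w, j) \<in> V \<and> i \<noteq> j \<and> (v \<inter> w = {} \<or> v = w)}\<rparr>)"

lemma pair_graph_extended_2_odd_graph: "pair_graph (extended_2_odd_graph k)"
proof -
  let ?G = "extended_2_odd_graph k"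
  have fin: "finite (pverts ?G)"
    unfolding extended_2_odd_graph_def Let_def
    by (auto intro: finite_subset[of _ "Pow {1..2 * k - 1}"])
  have sub: "parcs ?G \<subseteq> pverts ?G \<times> pverts ?G"
    by (auto simp: extended_2_odd_graph_def Let_def)
  have "finite (parcs ?G)"
    using finite_subset[OF sub] fin by blast
  moreover have "sym (parcs ?G)"
    by (auto simp: extended_2_odd_graph_def Let_def sym_def)
  ultimately show ?thesis
    using fin sub
    by unfold_locales
      (auto simp: symmetric_def with_proj_def arcs_ends_def arc_to_ends_def
         extended_2_odd_graph_def Let_def)
qed

definition graph_auto :: "'a pair_pre_digraph \<Rightarrow> ('a \<Rightarrow> 'a) set" where
  "graph_auto G = {f \<in> Bij (pverts G).
     \<forall>u \<in> pverts G. \<forall>v \<in> pverts G. (u, v) \<in> parcs G \<longleftrightarrow> (f u, f v) \<in> parcs G}"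

text \<open>Built like \<^const>\<open>AutoGroup\<close>; in particular automorphisms are extensional functions.\<close>

definition GraphAutoGroup :: "'a pair_pre_digraph \<Rightarrow> ('a \<Rightarrow> 'a) monoid" where
  "GraphAutoGroup G = BijGroup (pverts G) \<lparr>carrier := graph_auto G\<rparr>"

lemma subgroup_graph_auto: "subgroup (graph_auto G) (BijGroup (pverts G))"
proof (rule group.subgroupI[OF group_BijGroup])
  show "graph_auto G \<subseteq> carrier (BijGroup (pverts G))"
    by (auto simp: graph_auto_def BijGroup_def)
  have "(\<lambda>x \<in> pverts G. x) \<in> graph_auto G"
    by (simp add: graph_auto_def id_Bij)
  then show "graph_auto G \<noteq> {}" by blast
next
  fix f assume f: "f \<in> graph_auto G"
  let ?g = "\<lambda>x \<in> pverts G. inv_into (pverts G) f x"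
  from f have B: "f \<in> Bij (pverts G)" by (simp add: graph_auto_def)
  then have bij: "bij_betw f (pverts G) (pverts G)" by (simp add: Bij_def)
  have in_V: "inv_into (pverts G) f u \<in> pverts G" if "u \<in> pverts G" for u
    using bij that by (metis bij_betw_imp_surj_on inv_into_into)
  have inv: "f (inv_into (pverts G) f u) = u" if "u \<in> pverts G" for u
    using bij that by (simp add: bij_betw_inv_into_right)
  have "?g \<in> graph_auto G"
    using f restrict_inv_into_Bij[OF B] in_V inv by (simp add: graph_auto_def)
  then show "inv\<^bsub>BijGroup (pverts G)\<^esub> f \<in> graph_auto G"
    using inv_BijGroup[OF B] by simp
next
  fix f g assume fg: "f \<in> graph_auto G" "g \<in> graph_auto G"
  then have "f \<in> Bij (pverts G)" "g \<in> Bij (pverts G)" by (auto simp: graph_auto_def)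
  moreover from this have "\<And>u. u \<in> pverts G \<Longrightarrow> g u \<in> pverts G"
    by (auto dest: Bij_imp_funcset)
  ultimately show "f \<otimes>\<^bsub>BijGroup (pverts G)\<^esub> g \<in> graph_auto G"
    using fg by (auto simp: graph_auto_def BijGroup_def compose_Bij compose_eq)
qed

lemma group_GraphAutoGroup: "group (GraphAutoGroup G)"
  unfolding GraphAutoGroup_def
  by (rule group.subgroup_imp_group[OF group_BijGroup subgroup_graph_auto])

end

theory Submission
  imports Defs
begin

text \<open>
  Write \<open>X = {1..2k-1}\<close>. The arcs of \<open>E(2.O\<^sub>k)\<close> are of two kinds: the matching arcs between
  \<open>(v,0)\<close> and \<open>(v,1)\<close>, and the arcs between \<open>(v,i)\<close> and \<open>(w,1-i)\<close> with \<open>v\<close> and \<open>w\<close> disjoint.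
  The two kinds can be told apart by counting 4-cycles. For each of the \<open>k\<close> sets \<open>w\<close> disjoint from
  \<open>v\<close>, the four vertices over \<open>v\<close> and \<open>w\<close> form a 4-cycle, and for \<open>k \<ge> 3\<close> there are no others
  (\<open>square_with_disjoint_edge\<close>); so a matching edge lies in \<open>k\<close> of them and any other edge in
  exactly one. Hence an automorphism preserves the matching (\<open>graph_auto_matching\<close>) and induces an
  automorphism of the quotient, which is the Odd graph \<open>O\<^sub>k\<close>. If the two vertices over
  \<open>v\<close> change sheets, then so do those over the neighbours of \<open>v\<close> in \<open>O\<^sub>k\<close>; as \<open>O\<^sub>k\<close> is connected,
  the automorphism exchanges the two sheets everywhere or nowhere (\<open>graph_auto_is_twist\<close>). This bit is the factor \<open>\<int>\<^sub>2\<close>.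

  It remains to see that every automorphism \<open>s\<close> of \<open>O\<^sub>k\<close> comes from a permutation of \<open>X\<close>
  (\<open>odd_graph_automorphism\<close>). Label the edge between disjoint sets \<open>v\<close> and \<open>w\<close> by the only point
  of \<open>X\<close> that lies in neither. Opposite edges of a hexagon have the same label
  (\<open>hexagon_opposite_missing_point\<close>), and conversely any two edges with label \<open>x\<close> are linked by a
  chain of hexagons, each of which exchanges one point between the two halves of \<open>X - {x}\<close>. So
  having equal labels is a property of the graph alone, and \<open>s\<close> induces a map \<open>q\<close> of labels. The
  labels at the vertex \<open>v\<close> are the points of \<open>X - v\<close>; thus \<open>q\<close> maps \<open>X - v\<close> onto \<open>X - s v\<close>,
  whence \<open>q\<close> is a permutation and \<open>s v = q ` v\<close>.
\<close>

section \<open>Subsets of a fixed size\<close>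

text \<open>
  Any two subsets of the same size are linked by single exchanges. This gives both the
  connectedness of the Odd graph and the chains of hexagons between edges with the same label.
\<close>

lemma exchange_induct:
  assumes "finite X" "v \<subseteq> X" "w \<subseteq> X" "card v = card w" "P v"
    and step: "\<And>u a b. u \<subseteq> X \<Longrightarrow> card u = card w \<Longrightarrow> a \<in> u \<Longrightarrow> b \<in> X - u \<Longrightarrow> P u
                 \<Longrightarrow> P (insert b (u - {a}))"
  shows "P w"
  using assms(2,4,5)
proof (induction "card (v - w)" arbitrary: v)
  case 0
  have "finite v" "finite w" using 0 assms finite_subset by blast+
  with 0 have "v \<subseteq> w" by simp
  then show ?case using 0 \<open>finite w\<close> card_subset_eq by metis
next
  case (Suc n)
  have fin: "finite v" "finite w" using Suc assms finite_subset by blast+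
  obtain a where a: "a \<in> v - w" using Suc.hyps(2) by (metis card.empty all_not_in_conv nat.distinct(1))
  obtain b where b: "b \<in> w - v"
    using a fin Suc.prems(2) by (metis Diff_eq_empty_iff Diff_iff all_not_in_conv card_subset_eq)
  let ?v = "insert b (v - {a})"
  have "card ?v = card w" using a b fin Suc.prems(2)
    by (metis DiffD1 DiffD2 card.remove card_insert_disjoint finite_Diff)
  moreover have "?v \<subseteq> X" using b assms(3) Suc.prems(1) by auto
  moreover have "?v - w = (v - w) - {a}" using b by auto
  then have "n = card (?v - w)" using a fin Suc.hyps(2) by simp
  moreover have "P ?v" using step[of v a b] a b assms(3) Suc.prems by auto
  ultimately show ?case using Suc.hyps(1) by metis
qed

text \<open>For \<open>card X = 2 * m + 1\<close> these are the vertices of the Odd graph \<open>O\<^bsub>m+1\<^esub>\<close>.\<close>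

definition layer :: "'a set \<Rightarrow> nat \<Rightarrow> 'a set set" where
  "layer X m = {v. v \<subseteq> X \<and> card v = m}"

lemma finite_layer: "finite X \<Longrightarrow> finite (layer X m)"
  by (rule finite_subset[of _ "Pow X"]) (auto simp: layer_def)

lemma layer_compl_remove:
  assumes "finite X" "card X = 2 * m + 1" "v \<in> layer X m" "x \<in> X - v"
  shows "X - v - {x} \<in> layer X m"
proof -
  have "finite v" using assms finite_subset by (auto simp: layer_def)
  then show ?thesis using assms by (auto simp: layer_def card_Diff_subset)
qed

lemma layer_avoiding_point:
  assumes "finite X" "card X = 2 * m + 1"
  obtains v where "v \<in> layer X m" "x \<notin> v"
proof -
  have "m \<le> card (X - {x})" using assms by (simp add: card_Diff_singleton_if)
  then obtain v where "v \<subseteq> X - {x}" "card v = m" by (metis obtain_subset_with_card_n)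
  then show thesis using that[of v] by (auto simp: layer_def)
qed

text \<open>
  For disjoint \<open>v\<close> and \<open>w\<close>, that is, for an edge of the Odd graph, \<open>X - v - w\<close> is the singleton of
  the label of this edge.
\<close>

lemma missing_point:
  assumes "finite X" "card X = 2 * m + 1" "v \<in> layer X m" "w \<in> layer X m" "v \<inter> w = {}"
  obtains x where "x \<in> X - v" "X - v - w = {x}" "w = X - v - {x}"
proof -
  have "finite v" "finite w" using assms finite_subset by (auto simp: layer_def)
  moreover have "w \<subseteq> X - v" using assms by (auto simp: layer_def)
  ultimately have "card (X - v - w) = 1" using assms by (simp add: card_Diff_subset layer_def)
  then obtain x where x: "X - v - w = {x}" using card_1_singletonE by blast
  have "x \<in> X - v" "w = X - v - {x}" using x \<open>w \<subseteq> X - v\<close> by blast+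
  with x that show thesis by blast
qed

section \<open>Automorphisms of the Odd graph\<close>

text \<open>
  A set disjoint from \<open>v\<close> is determined by the point that it omits from \<open>X - v\<close>. For \<open>u\<close> this point
  is \<open>x\<close>, so a walk \<open>u, v, w\<close> that does not return to \<open>u\<close> has to pick up \<open>x\<close>.
\<close>

lemma turn_contains_missing_point:
  assumes "finite X" "card X = 2 * m + 1"
    and S: "u \<in> layer X m" "v \<in> layer X m" "w \<in> layer X m"
    and uv: "u \<inter> v = {}" and vw: "v \<inter> w = {}" and "w \<noteq> u"
    and "x \<in> X - u - v"
  shows "x \<in> w"
proof (rule ccontr)
  assume "x \<notin> w"
  obtain y where y: "X - v - w = {y}" "w = X - v - {y}"
    by (rule missing_point[OF assms(1,2) S(2,3) vw])
  have "v \<inter> u = {}" using uv by blast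
  then obtain z where z: "X - v - u = {z}" "u = X - v - {z}"
    by (rule missing_point[OF assms(1,2) S(2,1)])
  have "x = y" using y \<open>x \<notin> w\<close> assms by blast
  moreover have "x = z" using z assms by blast
  ultimately show False using y z assms by simp
qed

text \<open>
  The label \<open>x\<close> of the first edge is picked up at both \<open>v2\<close> and \<open>v5\<close>, hence it lies neither in
  \<open>v3\<close>, a neighbour of \<open>v2\<close>, nor in \<open>v4\<close>, a neighbour of \<open>v5\<close>.
\<close>

lemma hexagon_opposite_missing_point:
  assumes X: "finite X" "card X = 2 * m + 1"
    and S: "{v0, v1, v2, v3, v4, v5} \<subseteq> layer X m"
    and cyc: "v0 \<inter> v1 = {}" "v1 \<inter> v2 = {}" "v2 \<inter> v3 = {}" "v3 \<inter> v4 = {}" "v4 \<inter> v5 = {}" "v5 \<inter> v0 = {}"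
    and "v2 \<noteq> v0" "v5 \<noteq> v1"
  shows "X - v0 - v1 = X - v3 - v4"
proof -
  obtain x where x: "X - v0 - v1 = {x}"
    by (rule missing_point[OF X _ _ cyc(1)]) (use S in auto)
  obtain y where y: "X - v3 - v4 = {y}"
    by (rule missing_point[OF X _ _ cyc(4)]) (use S in auto)
  have "x \<in> v2"
    
    by (rule turn_contains_missing_point[OF X, of v0 v1 v2]) (use S cyc x assms in auto)
  moreover have "x \<in> v5"
    
    by (rule turn_contains_missing_point[OF X, of v1 v0 v5]) (use S cyc x assms in auto)
  ultimately have "x \<in> X - v3 - v4" using x cyc by blast
  then show ?thesis using x y by auto
qed

text \<open>Each exchange of one point is a walk of length two, through the complement of the union.\<close>

lemma odd_graph_connected:
  assumes X: "finite X" "card X = 2 * m + 1"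
    and S: "v \<in> layer X m" "w \<in> layer X m" and "P v"
    and step: "\<And>u u'. u \<in> layer X m \<Longrightarrow> u' \<in> layer X m \<Longrightarrow> u \<inter> u' = {} \<Longrightarrow> P u \<Longrightarrow> P u'"
  shows "P w"
proof (rule exchange_induct[of X v w P])
  fix u a b assume u: "u \<subseteq> X" "card u = card w" "a \<in> u" "b \<in> X - u" "P u"
  have uS: "u \<in> layer X m" using u S by (simp add: layer_def)
  let ?t = "X - u - {b}"
  have t: "?t \<in> layer X m" using layer_compl_remove[OF X uS] u by blast
  have "X - ?t - {a} \<in> layer X m" using layer_compl_remove[OF X t, of a] u by blast
  moreover have "X - ?t - {a} = insert b (u - {a})" using u by auto
  ultimately have r: "insert b (u - {a}) \<in> layer X m" by simp
  have "P ?t" using step[OF uS t] u by blast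
  then show "P (insert b (u - {a}))" using step[OF t r] by blast
qed (use assms in \<open>auto simp: layer_def\<close>)

theorem odd_graph_automorphism:
  assumes X: "finite X" "card X = 2 * m + 1"
    and bij: "bij_betw s (layer X m) (layer X m)"
    and adj: "\<And>v w. v \<in> layer X m \<Longrightarrow> w \<in> layer X m \<Longrightarrow> s v \<inter> s w = {} \<longleftrightarrow> v \<inter> w = {}"
  obtains p where "p permutes X" "\<And>v. v \<in> layer X m \<Longrightarrow> s v = p ` v"
proof -
  let ?S = "layer X m"
  have sS: "s v \<in> ?S" if "v \<in> ?S" for v using bij that by (auto dest: bij_betwE)
  have s_eq: "s v = s w \<longleftrightarrow> v = w" if "v \<in> ?S" "w \<in> ?S" for v w
    using bij that by (auto simp: bij_betw_def dest: inj_onD)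
  \<comment> \<open>The edge with label \<open>x\<close> at \<open>v\<close> goes to \<open>X - v - {x}\<close>; \<open>L x v\<close> is the singleton of the
      label of its image.\<close>
  define L where "L x v = X - s v - s (X - v - {x})" for x v
  have const: "L x v = L x w"
    if x: "x \<in> X" and v: "v \<in> ?S" "x \<notin> v" and w: "w \<in> ?S" "x \<notin> w" for x v w
  proof (rule exchange_induct[of "X - {x}" v w "\<lambda>u. L x v = L x u"])
    fix u a b assume u: "u \<subseteq> X - {x}" "card u = card w" "a \<in> u" "b \<in> X - {x} - u"
      and IH: "L x v = L x u"
    have v0: "u \<in> ?S" using u w by (auto simp: layer_def)
    \<comment> \<open>The hexagon with labels \<open>x, a, b, x, a, b\<close> starting at \<open>u\<close>: its first edge is the one
        with label \<open>x\<close> at \<open>u\<close>, and the opposite edge is the one with label \<open>x\<close> at the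
        exchanged set.\<close>
    define v1 where "v1 = X - u - {x}"
    define v2 where "v2 = X - v1 - {a}"
    define v3 where "v3 = X - v2 - {b}"
    define v4 where "v4 = X - v3 - {x}"
    define v5 where "v5 = X - v4 - {a}"
    have v1: "v1 \<in> ?S" unfolding v1_def using u x by (intro layer_compl_remove[OF X v0]) auto
    have v2: "v2 \<in> ?S" unfolding v2_def
      using u x by (intro layer_compl_remove[OF X v1]) (auto simp: v1_def)
    have v3: "v3 \<in> ?S" unfolding v3_def
      using u x by (intro layer_compl_remove[OF X v2]) (auto simp: v1_def v2_def)
    have v4: "v4 \<in> ?S" unfolding v4_def
      using u x by (intro layer_compl_remove[OF X v3]) (auto simp: v1_def v2_def v3_def)
    have v5: "v5 \<in> ?S" unfolding v5_def
      using u x by (intro layer_compl_remove[OF X v4]) (auto simp: v1_def v2_def v3_def v4_def)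
    have v4': "v4 = insert b (u - {a})" and v3': "v3 = X - v4 - {x}"
      using u x by (auto simp: v1_def v2_def v3_def v4_def)
    have v50: "v5 \<inter> u = {}" and v51: "v5 \<noteq> v1" and v20: "v2 \<noteq> u"
      using u x unfolding v5_def v4' by (auto simp: v1_def v2_def)
    have "X - s u - s v1 = X - s v3 - s v4"
    proof (rule hexagon_opposite_missing_point[OF X, of "s u" "s v1" "s v2" "s v3" "s v4" "s v5"])
      show "s u \<inter> s v1 = {}" using adj[OF v0 v1] by (auto simp: v1_def)
      show "s v1 \<inter> s v2 = {}" using adj[OF v1 v2] by (auto simp: v2_def)
      show "s v2 \<inter> s v3 = {}" using adj[OF v2 v3] by (auto simp: v3_def)
      show "s v3 \<inter> s v4 = {}" using adj[OF v3 v4] by (auto simp: v4_def)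
      show "s v4 \<inter> s v5 = {}" using adj[OF v4 v5] by (auto simp: v5_def)
      show "s v5 \<inter> s u = {}" using adj[OF v5 v0] v50 by simp
      show "s v2 \<noteq> s u" "s v5 \<noteq> s v1" using s_eq v0 v1 v2 v5 v51 v20 by auto
    qed (use sS v0 v1 v2 v3 v4 v5 in auto)
    then have "L x u = L x v4" by (auto simp: L_def v1_def simp flip: v3')
    then show "L x v = L x (insert b (u - {a}))" using IH v4' by simp
  qed (use X v w in \<open>auto simp: layer_def\<close>)
  define q where "q x = the_elem (L x (SOME v. v \<in> ?S \<and> x \<notin> v))" for x
  have q: "L x v = {q x}" if x: "x \<in> X" and v: "v \<in> ?S" "x \<notin> v" for x v
  proof -
    have "\<exists>u. u \<in> ?S \<and> x \<notin> u" using v by blast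
    from someI_ex[OF this] have "q x = the_elem (L x v)"
      unfolding q_def using const[OF x _ _ v] by simp
    moreover have w: "X - v - {x} \<in> ?S" using layer_compl_remove[OF X v(1)] x v by blast
    moreover have "s v \<inter> s (X - v - {x}) = {}" using adj[OF v(1) w] by blast
    then obtain y where "L x v = {y}"
      using missing_point[OF X sS[OF v(1)] sS[OF w]] unfolding L_def by metis
    ultimately show ?thesis by simp
  qed
  have image: "q ` (X - v) = X - s v" if v: "v \<in> ?S" for v
  proof
    show "q ` (X - v) \<subseteq> X - s v" using q v by (fastforce simp: L_def)
    show "X - s v \<subseteq> q ` (X - v)"
    proof
      fix y assume y: "y \<in> X - s v"
      have "X - s v - {y} \<in> ?S" by (rule layer_compl_remove[OF X sS[OF v] y])
      then obtain w where w: "w \<in> ?S" "s w = X - s v - {y}"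
        using bij by (metis bij_betw_imp_surj_on imageE)
      have "v \<inter> w = {}" using adj[OF v w(1)] w(2) by blast
      then obtain x where x: "x \<in> X - v" "w = X - v - {x}"
        using missing_point[OF X v w(1)] by metis
      have "L x v = {y}" unfolding L_def x(2)[symmetric] w(2) using y by blast
      then show "y \<in> q ` (X - v)" using q[of x v] x v by auto
    qed
  qed
  have "q ` X = X"
  proof
    show "X \<subseteq> q ` X"
    proof
      fix y assume y: "y \<in> X"
      obtain v where "v \<in> ?S" "y \<notin> v" by (rule layer_avoiding_point[OF X])
      then obtain u where "u \<in> ?S" "y \<notin> s u" using bij by (metis bij_betw_imp_surj_on imageE)
      then show "y \<in> q ` X" using image[of u] y by blast
    qed
    show "q ` X \<subseteq> X"
    proof
      fix y assume "y \<in> q ` X"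
      then obtain x where x: "x \<in> X" "y = q x" by blast
      obtain v where "v \<in> ?S" "x \<notin> v" by (rule layer_avoiding_point[OF X])
      then show "y \<in> X" using image[of v] x by blast
    qed
  qed
  then have q_bij: "bij_betw q X X"
    using X by (simp add: bij_betw_def eq_card_imp_inj_on)
  show thesis
  proof
    let ?p = "\<lambda>x. if x \<in> X then q x else x"
    have "bij_betw ?p X X" using q_bij by (simp cong: bij_betw_cong)
    then show "?p permutes X" by (rule bij_imp_permutes) simp
    fix v assume v: "v \<in> ?S"
    then have sub: "v \<subseteq> X" by (simp add: layer_def)
    have "?p ` v = q ` v" using sub by (intro image_cong) auto
    also have "\<dots> = q ` (X - (X - v))" using sub by (simp add: double_diff)
    also have "\<dots> = q ` X - q ` (X - v)"
      using q_bij by (intro inj_on_image_set_diff[of q X]) (auto simp: bij_betw_def)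
    also have "\<dots> = s v" using image[OF v] \<open>q ` X = X\<close> sS[OF v] by (auto simp: layer_def)
    finally show "s v = ?p ` v" by simp
  qed
qed


section \<open>The matching edges of the extended graph\<close>

text \<open>
  The sets \<open>v, w, v', w'\<close> are those of a closed walk of length four whose first edge is not in the
  matching. Two sets \<open>v \<noteq> v'\<close> leave at most \<open>m\<close> points of \<open>X\<close> outside their union, so only one set
  can be disjoint from both. If \<open>v' \<noteq> w\<close>, then \<open>w\<close> is that set, \<open>w'\<close> must be \<open>v\<close> or \<open>v'\<close>, and \<open>v, v', w\<close>
  are pairwise disjoint. This is impossible because \<open>3 m > 2 m + 1\<close>; it is here that \<open>k \<ge> 3\<close>
  matters.
\<close>

lemma square_with_disjoint_edge:
  assumes X: "finite X" "card X = 2 * m + 1" and m: "m \<ge> 2"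
    and S: "v \<in> layer X m" "w \<in> layer X m" "v' \<in> layer X m" "w' \<in> layer X m"
    and ne: "v' \<noteq> v" "w' \<noteq> w"
    and vw: "v \<inter> w = {}"
    and adj: "w \<inter> v' = {} \<or> w = v'" "v' \<inter> w' = {} \<or> v' = w'" "w' \<inter> v = {} \<or> w' = v"
  shows "v' = w"
proof (rule ccontr)
  assume "v' \<noteq> w"
  then have wv': "w \<inter> v' = {}" using adj by auto
  have fin: "finite v" "finite w" "finite v'" "finite w'"
    using S X finite_subset by (auto simp: layer_def)
  have card: "card v = m" "card w = m" "card v' = m" "card w' = m"
    and sub: "v \<subseteq> X" "w \<subseteq> X" "v' \<subseteq> X" "w' \<subseteq> X"
    using S by (auto simp: layer_def)
  have nd: "v \<inter> v' \<noteq> {}"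
  proof
    assume "v \<inter> v' = {}"
    then have "card (v \<union> v') = 2 * m" using fin card by (simp add: card_Un_disjoint)
    moreover have "(v \<union> v') \<inter> w = {}" using vw wv' by blast
    ultimately have "card (v \<union> v' \<union> w) = 3 * m" using fin card by (simp add: card_Un_disjoint)
    moreover have "card (v \<union> v' \<union> w) \<le> 2 * m + 1"
      using sub X by (metis card_mono le_sup_iff)
    ultimately show False using m by simp
  qed
  then have w': "w' \<subseteq> X - (v \<union> v')" using adj ne sub by blast
  have w: "w \<subseteq> X - (v \<union> v')" using vw wv' sub by blast
  have "\<not> v' \<subseteq> v" using ne(1) card fin card_subset_eq by metis
  then have "v \<subset> v \<union> v'" by blast
  then have "m < card (v \<union> v')" using fin card by (metis finite_UnI psubset_card_mono)
  then have "card (X - (v \<union> v')) \<le> m" using fin sub X by (simp add: card_Diff_subset)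
  then have "w = X - (v \<union> v')" "w' = X - (v \<union> v')"
    using w w' X card by (metis card_seteq finite_Diff)+
  then show False using ne by simp
qed

lemma pverts_extended:
  "pverts (extended_2_odd_graph k) = layer {1..2 * k - 1} (k - 1) \<times> {0, 1}"
  by (simp add: extended_2_odd_graph_def layer_def Let_def)

lemma parcs_extended:
  "((v, i), (w, j)) \<in> parcs (extended_2_odd_graph k) \<longleftrightarrow>
     v \<in> layer {1..2 * k - 1} (k - 1) \<and> w \<in> layer {1..2 * k - 1} (k - 1) \<and>
     i \<in> {0, 1} \<and> j \<in> {0, 1} \<and> i \<noteq> j \<and> (v \<inter> w = {} \<or> v = w)"
  by (auto simp: extended_2_odd_graph_def layer_def Let_def)

text \<open>
  A matching edge lies in at least two 4-cycles. If its image were not a matching edge, then by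
  \<open>square_with_disjoint_edge\<close> both 4-cycles would have the same image.
\<close>

lemma graph_auto_matching:
  assumes k: "k \<ge> 3" and f: "f \<in> graph_auto (extended_2_odd_graph k)"
    and v: "v \<in> layer {1..2 * k - 1} (k - 1)"
  shows "fst (f (v, 1)) = fst (f (v, 0))"
proof (rule ccontr)
  let ?X = "{1..2 * k - 1}" and ?G = "extended_2_odd_graph k"
  let ?S = "layer ?X (k - 1)"
  have X: "finite ?X" "card ?X = 2 * (k - 1) + 1" using k by auto
  have arc: "(f x, f y) \<in> parcs ?G" if "(x, y) \<in> parcs ?G" for x y
    using that f pair_graph_extended_2_odd_graph[of k]
    by (cases x; cases y) (auto simp: graph_auto_def parcs_extended pverts_extended)
  have inj: "inj_on f (pverts ?G)" using f by (auto simp: graph_auto_def Bij_def bij_betw_def)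
  obtain a i b j where ab: "f (v, 0) = (a, i)" "f (v, 1) = (b, j)" by fastforce
  assume "fst (f (v, 1)) \<noteq> fst (f (v, 0))"
  moreover have 1: "((a, i), (b, j)) \<in> parcs ?G"
    using arc[of "(v, 0)" "(v, 1)"] ab v by (simp add: parcs_extended)
  ultimately have disj: "a \<inter> b = {}" using ab by (auto simp: parcs_extended)
  \<comment> \<open>The image of the 4-cycle over \<open>v\<close> and \<open>w\<close> has the edge from \<open>a\<close> to \<open>b\<close> outside the matching,
      which leaves only one choice for the image of \<open>(w, 0)\<close>.\<close>
  have determined: "f (w, 0) = (b, i)" if w: "w \<in> ?S" "v \<inter> w = {}" for w
  proof -
    obtain a' i' b' j' where ab': "f (w, 0) = (a', i')" "f (w, 1) = (b', j')" by fastforce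
    have 2: "((b, j), (a', i')) \<in> parcs ?G" "((a', i'), (b', j')) \<in> parcs ?G"
        "((b', j'), (a, i)) \<in> parcs ?G"
      using arc[of "(v, 1)" "(w, 0)"] arc[of "(w, 0)" "(w, 1)"] arc[of "(w, 1)" "(v, 0)"]
        ab ab' v w by (auto simp: parcs_extended)
    then have ij: "i' = i" "j' = j" using 1 by (auto simp: parcs_extended)
    have "v \<noteq> w" using w k by (auto simp: layer_def)
    then have "f (w, 0) \<noteq> f (v, 0)" "f (w, 1) \<noteq> f (v, 1)"
      using inj v w by (auto simp: pverts_extended dest!: inj_onD)
    then have "a' \<noteq> a" "b' \<noteq> b" using ab ab' ij by auto
    moreover have "k - 1 \<ge> 2" using k by simp
    ultimately have "a' = b"
      using square_with_disjoint_edge[OF X, of a b a' b'] disj 1 2 by (simp add: parcs_extended)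
    then show ?thesis using ab' ij by simp
  qed
  have "finite v" using v finite_subset by (auto simp: layer_def)
  then have "card (?X - v) = k"
    using v X by (simp add: layer_def card_Diff_subset)
  then have "\<not> card (?X - v) \<le> Suc 0" using k by simp
  then obtain x y where xy: "x \<in> ?X - v" "y \<in> ?X - v" "x \<noteq> y"
    using card_le_Suc0_iff_eq[of "?X - v"] X(1) by blast
  have S: "?X - v - {x} \<in> ?S" "?X - v - {y} \<in> ?S"
    using layer_compl_remove[OF X v] xy by blast+
  then have "f (?X - v - {x}, 0) = f (?X - v - {y}, 0)"
    using determined by (metis Diff_disjoint Int_Diff Diff_empty empty_Diff)
  then have "?X - v - {x} = ?X - v - {y}"
    using inj S by (auto simp: pverts_extended dest!: inj_onD)
  then show False using xy by blast
qed

section \<open>Automorphisms as pairs of a sheet exchange and a permutation\<close>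

text \<open>
  The restriction to the vertices is needed because automorphisms are extensional functions. The
  shift \<open>a\<close> is an integer because the elements of \<^term>\<open>integer_mod_group 2\<close> are.
\<close>

definition twist :: "nat \<Rightarrow> int \<times> (nat \<Rightarrow> nat) \<Rightarrow> nat set \<times> nat \<Rightarrow> nat set \<times> nat" where
  "twist k = (\<lambda>(a, p). \<lambda>(v, i) \<in> pverts (extended_2_odd_graph k). (p ` v, (i + nat a) mod 2))"

text \<open>
  The map \<open>s\<close> describes how \<open>f\<close> moves the pairs \<open>{(v,0), (v,1)}\<close>, and \<open>e v\<close> tells whether \<open>f\<close>
  exchanges the two sheets over \<open>v\<close>. If \<open>v\<close> and \<open>w\<close> are disjoint, then the edge from \<open>(v,0)\<close> to
  \<open>(w,1)\<close> forces \<open>e v = e w\<close>.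
\<close>

lemma graph_auto_is_twist:
  assumes k: "k \<ge> 3" and f: "f \<in> graph_auto (extended_2_odd_graph k)"
  obtains a p where "a \<in> {0, 1}" "p permutes {1..2 * k - 1}" "f = twist k (a, p)"
proof -
  let ?X = "{1..2 * k - 1}" and ?G = "extended_2_odd_graph k"
  let ?S = "layer ?X (k - 1)"
  have X: "finite ?X" "card ?X = 2 * (k - 1) + 1" using k by auto
  have bij: "bij_betw f (?S \<times> {0, 1}) (?S \<times> {0, 1})" and ext: "f \<in> extensional (?S \<times> {0, 1})"
    using f by (auto simp: graph_auto_def Bij_def pverts_extended)
  have arc: "((v, i), (w, j)) \<in> parcs ?G \<longleftrightarrow> (f (v, i), f (w, j)) \<in> parcs ?G"
    if "v \<in> ?S" "w \<in> ?S" "i \<in> {0, 1}" "j \<in> {0, 1}" for v w i j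
  proof -
    have "(v, i) \<in> pverts ?G" "(w, j) \<in> pverts ?G" using that by (auto simp: pverts_extended)
    then show ?thesis using f unfolding graph_auto_def by blast
  qed
  define s where "s v = fst (f (v, 0))" for v
  define e where "e v = snd (f (v, 0))" for v
  have se: "s v \<in> ?S" "e v \<in> {0, 1}" if "v \<in> ?S" for v
  proof -
    have "f (v, 0) \<in> ?S \<times> {0, 1}" using bij_betwE[OF bij] that by blast
    then show "s v \<in> ?S" "e v \<in> {0, 1}" by (simp_all add: s_def e_def mem_Times_iff)
  qed
  have f0: "f (v, 0) = (s v, e v)" for v by (simp add: s_def e_def)
  have f1: "f (v, 1) = (s v, 1 - e v)" if v: "v \<in> ?S" for v
  proof -
    have "((s v, e v), f (v, 1)) \<in> parcs ?G"
      using arc[of v v 0 1] v by (simp add: f0 parcs_extended)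
    moreover have "fst (f (v, 1)) = s v"
      unfolding s_def by (rule graph_auto_matching[OF k f v])
    ultimately show ?thesis by (cases "f (v, 1)") (auto simp: parcs_extended)
  qed
  have s_inj: "v = w" if "v \<in> ?S" "w \<in> ?S" "s v = s w" for v w
  proof -
    have "f (v, 0) \<in> {f (w, 0), f (w, 1)}"
      using se[of v] se[of w] that by (auto simp: f0 f1[of w, simplified])
    then show ?thesis using that bij unfolding bij_betw_def inj_on_def by blast
  qed
  have ne: "v \<noteq> {}" if "v \<in> ?S" for v using that k by (auto simp: layer_def)
  have edge: "(v \<inter> w = {} \<or> v = w) \<longleftrightarrow> (s v \<inter> s w = {} \<or> s v = s w) \<and> e v = e w"
    if "v \<in> ?S" "w \<in> ?S" for v w
  proof -
    have "(v \<inter> w = {} \<or> v = w) \<longleftrightarrow> ((v, 0), (w, 1)) \<in> parcs ?G"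
      using that by (simp add: parcs_extended)
    also have "\<dots> \<longleftrightarrow> ((s v, e v), (s w, 1 - e w)) \<in> parcs ?G"
      using arc[OF that, of 0 1] by (simp add: f0 f1[OF that(2), simplified])
    also have "\<dots> \<longleftrightarrow> (s v \<inter> s w = {} \<or> s v = s w) \<and> e v = e w"
      using se[OF that(1)] se[OF that(2)] unfolding parcs_extended by force
    finally show ?thesis .
  qed
  have e_eq: "e v = e w" if "v \<in> ?S" "w \<in> ?S" for v w
  proof (rule odd_graph_connected[OF X that, where P = "\<lambda>u. e v = e u"])
    fix u u' assume "u \<in> ?S" "u' \<in> ?S" "u \<inter> u' = {}" "e v = e u"
    then show "e v = e u'" using edge[of u u'] by simp
  qed simp
  have adj: "s v \<inter> s w = {} \<longleftrightarrow> v \<inter> w = {}" if "v \<in> ?S" "w \<in> ?S" for v w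
    using edge[OF that] e_eq[OF that] s_inj[OF that] ne[of v] ne[of "s v"] se[of v] that by blast
  obtain v0 where v0: "v0 \<in> ?S" by (rule layer_avoiding_point[OF X])
  have inj: "inj_on s ?S"
    by (rule inj_onI) (rule s_inj)
  moreover have "s ` ?S = ?S"
  proof (rule endo_inj_surj)
    show "finite ?S" by (simp add: finite_layer)
    show "s ` ?S \<subseteq> ?S" using se by blast
  qed (rule inj)
  ultimately have "bij_betw s ?S ?S" by (simp add: bij_betw_def)
  then obtain p where p: "p permutes ?X" "\<And>v. v \<in> ?S \<Longrightarrow> s v = p ` v"
    using odd_graph_automorphism[OF X _ adj] by metis
  have "f = twist k (int (e v0), p)"
  proof (rule extensionalityI[OF ext])
    show "twist k (int (e v0), p) \<in> extensional (?S \<times> {0, 1})"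
      by (simp add: twist_def pverts_extended)
    fix x assume "x \<in> ?S \<times> {0, 1 :: nat}"
    then obtain v i where x: "x = (v, i)" "v \<in> ?S" "i \<in> {0, 1}" by blast
    then show "f x = twist k (int (e v0), p) x"
      using f0 f1[of v] p(2)[of v] e_eq[OF x(2) v0] se(2)[OF v0]
      by (auto simp: twist_def pverts_extended)
  qed
  then show thesis using that[of "int (e v0)" p] p se(2)[OF v0] by auto
qed

lemma twist_in_graph_auto:
  assumes k: "k \<ge> 3" and a: "a \<in> {0, 1}" and p: "p permutes {1..2 * k - 1}"
  shows "twist k (a, p) \<in> graph_auto (extended_2_odd_graph k)"
proof -
  let ?G = "extended_2_odd_graph k" and ?S = "layer {1..2 * k - 1} (k - 1)"
  have inj: "inj p" using p by (rule permutes_inj)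
  have S: "p ` v \<in> ?S" if "v \<in> ?S" for v
    using that inj permutes_image[OF p] by (auto simp: layer_def card_image inj_on_subset)
  have inj': "inj_on (twist k (a, p)) (pverts ?G)"
  proof (rule inj_onI)
    fix x y assume "x \<in> pverts ?G" "y \<in> pverts ?G" "twist k (a, p) x = twist k (a, p) y"
    then show "x = y"
      using a inj by (cases x; cases y) (auto simp: twist_def pverts_extended inj_image_eq_iff)
  qed
  have into: "twist k (a, p) ` pverts ?G \<subseteq> pverts ?G"
    using S a by (auto simp: twist_def pverts_extended)
  have "finite (pverts ?G)"
    by (simp add: pverts_extended finite_layer)
  then have "bij_betw (twist k (a, p)) (pverts ?G) (pverts ?G)"
    using inj' into by (simp add: bij_betw_def endo_inj_surj)
  moreover have "twist k (a, p) \<in> extensional (pverts ?G)" by (simp add: twist_def)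
  moreover have "(x, y) \<in> parcs ?G \<longleftrightarrow> (twist k (a, p) x, twist k (a, p) y) \<in> parcs ?G"
    if xy: "x \<in> pverts ?G" "y \<in> pverts ?G" for x y
  proof -
    obtain v i w j where x: "x = (v, i)" "y = (w, j)" by fastforce
    have "p ` v \<inter> p ` w = {} \<longleftrightarrow> v \<inter> w = {}" "p ` v = p ` w \<longleftrightarrow> v = w"
      using inj by (simp_all add: inj_image_eq_iff flip: image_Int)
    moreover have "(i + nat a) mod 2 = (j + nat a) mod 2 \<longleftrightarrow> i = j"
      using xy a by (auto simp: x pverts_extended)
    moreover have "v \<in> ?S" "w \<in> ?S" "i \<in> {0, 1}" "j \<in> {0, 1}"
      using xy by (auto simp: x pverts_extended)
    moreover have "(i + nat a) mod 2 \<in> {0, 1}" "(j + nat a) mod 2 \<in> {0, 1}" by auto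
    moreover have "twist k (a, p) x = (p ` v, (i + nat a) mod 2)"
        "twist k (a, p) y = (p ` w, (j + nat a) mod 2)"
      using xy by (simp_all add: twist_def x)
    ultimately show ?thesis using S unfolding x by (simp add: parcs_extended)
  qed
  ultimately show ?thesis by (simp add: graph_auto_def Bij_def)
qed

text \<open>
  If \<open>p x = q y\<close> with \<open>x \<noteq> y\<close>, then a set that contains \<open>x\<close> but not \<open>y\<close> has different images
  under \<open>p\<close> and \<open>q\<close>.
\<close>

lemma permutes_eq_if_layer_images_eq:
  assumes X: "finite X" "card X = 2 * m + 1" "m \<ge> 1"
    and p: "p permutes X" and q: "q permutes X"
    and eq: "\<And>v. v \<in> layer X m \<Longrightarrow> p ` v = q ` v"
  shows "p = q"
proof (rule ccontr)
  assume "p \<noteq> q"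
  then obtain x where x: "p x \<noteq> q x" by blast
  then have xX: "x \<in> X" using p q by (metis permutes_not_in)
  obtain y where y: "q y = p x" using permutes_surj[OF q] by (metis surjD)
  then have "y \<noteq> x" using x by auto
  have "m - 1 \<le> card (X - {x, y})" 
    using diff_card_le_card_Diff[of "{x, y}" X] X \<open>y \<noteq> x\<close> by simp
  then obtain u where u: "u \<subseteq> X - {x, y}" "card u = m - 1" by (metis obtain_subset_with_card_n)
  have "finite u" using u X finite_subset by blast
  then have "insert x u \<in> layer X m" using u xX X by (auto simp: layer_def card_insert_if)
  then have "p x \<in> q ` insert x u" using eq by blast
  then obtain z where z: "z \<in> insert x u" "q z = q y" unfolding y by (metis imageE)
  then have "z = y" using permutes_inj[OF q] by (auto dest: injD)
  then show False using z u \<open>y \<noteq> x\<close> by auto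
qed

theorem mainTheorem5:
  fixes k :: nat
  assumes "k \<ge> 3"
  shows "GraphAutoGroup (extended_2_odd_graph k) \<cong> integer_mod_group 2 \<times>\<times> sym_group (2 * k - 1)"
proof -
  let ?X = "{1..2 * k - 1}" and ?G = "extended_2_odd_graph k"
  let ?S = "layer ?X (k - 1)" and ?A = "GraphAutoGroup (extended_2_odd_graph k)"
  let ?H = "integer_mod_group 2 \<times>\<times> sym_group (2 * k - 1)"
  have X: "finite ?X" "card ?X = 2 * (k - 1) + 1" using assms by auto
  have H: "carrier ?H = {0, 1} \<times> {p. p permutes ?X}"
    by (auto simp: DirProd_def carrier_integer_mod_group sym_group_def)
  have A: "carrier ?A = graph_auto ?G" by (simp add: GraphAutoGroup_def)
  have "twist k \<in> hom ?H ?A"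
  proof (rule homI)
    show "twist k x \<in> carrier ?A" if "x \<in> carrier ?H" for x
      using that twist_in_graph_auto[OF assms] unfolding H A by blast
    fix x y assume x: "x \<in> carrier ?H" and y: "y \<in> carrier ?H"
    obtain a p b q where ab: "x = (a, p)" "y = (b, q)" by fastforce
    have T: "twist k x \<in> graph_auto ?G" "twist k y \<in> graph_auto ?G"
      using x y twist_in_graph_auto[OF assms] unfolding H ab by blast+
    then have B: "twist k x \<in> Bij (pverts ?G)" "twist k y \<in> Bij (pverts ?G)"
      by (auto simp: graph_auto_def)
    have "twist k x \<otimes>\<^bsub>?A\<^esub> twist k y = compose (pverts ?G) (twist k x) (twist k y)"
      using B by (simp add: GraphAutoGroup_def BijGroup_def)
    also have "\<dots> = twist k (x \<otimes>\<^bsub>?H\<^esub> y)"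
    proof (rule extensionalityI[of _ "pverts ?G"])
      fix z assume z: "z \<in> pverts ?G"
      then have z': "twist k y z \<in> pverts ?G" using B(2) by (auto dest: Bij_imp_funcset)
      obtain v i where vi: "z = (v, i)" by fastforce
      have mod: "((i + nat b) mod 2 + nat a) mod 2 = (i + nat ((a + b) mod 2)) mod 2"
        using x y z unfolding ab vi H pverts_extended by auto
      have y': "twist k y z = (q ` v, (i + nat b) mod 2)"
        using z by (simp add: ab vi twist_def)
      have "compose (pverts ?G) (twist k x) (twist k y) z = twist k x (twist k y z)"
        using z by (simp add: compose_eq)
      also have "\<dots> = (p ` q ` v, ((i + nat b) mod 2 + nat a) mod 2)"
        using z' unfolding y' by (simp add: ab twist_def)
      also have "\<dots> = twist k (x \<otimes>\<^bsub>?H\<^esub> y) z"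
        unfolding mod using z by (simp add: ab vi twist_def DirProd_def sym_group_def image_comp)
      finally show "compose (pverts ?G) (twist k x) (twist k y) z = twist k (x \<otimes>\<^bsub>?H\<^esub> y) z" .
    qed (auto simp: twist_def split: prod.splits)
    finally show "twist k (x \<otimes>\<^bsub>?H\<^esub> y) = twist k x \<otimes>\<^bsub>?A\<^esub> twist k y" ..
  qed
  moreover have "inj_on (twist k) (carrier ?H)"
  proof (rule inj_onI)
    fix x y assume x: "x \<in> carrier ?H" and y: "y \<in> carrier ?H" and eq: "twist k x = twist k y"
    obtain a p b q where ab: "x = (a, p)" "y = (b, q)" by fastforce
    have vals: "p ` v = q ` v \<and> nat a mod 2 = nat b mod 2" if "v \<in> ?S" for v
      using fun_cong[OF eq, of "(v, 0)"] that by (simp add: ab twist_def pverts_extended)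
    obtain v0 where "v0 \<in> ?S" by (rule layer_avoiding_point[OF X])
    then have "a = b" using vals x y unfolding H ab by auto
    moreover have "p = q"
    proof (rule permutes_eq_if_layer_images_eq[OF X])
      show "1 \<le> k - 1" using assms by simp
      show "p permutes ?X" "q permutes ?X" using x y unfolding H ab by blast+
    qed (use vals in blast)
    ultimately show "x = y" using ab by simp
  qed
  moreover have "twist k ` carrier ?H = carrier ?A"
  proof
    show "twist k ` carrier ?H \<subseteq> carrier ?A"
      using twist_in_graph_auto[OF assms] unfolding H A by blast
    show "carrier ?A \<subseteq> twist k ` carrier ?H"
      using graph_auto_is_twist[OF assms] unfolding H A by blast
  qed
  ultimately have "twist k \<in> iso ?H ?A" by (simp add: iso_def bij_betw_def)
  then have "?H \<cong> ?A" by (auto simp: is_iso_def)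
  moreover have "group ?H"
    by (intro DirProd_group group_integer_mod_group sym_group_is_group)
  ultimately show ?thesis by (simp add: group.iso_sym)
qed

end
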